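(* Let $m$ be a positive integer, let $a_i,b_i,c_i\in\mathbb R$ for $i=0,\dots,m$, and let $$S(x,t)=\sum_{i=0}^m\big(a_i+b_i\cos(2\pi t)+c_i\sin(2\pi t)\big)x^i,\qquad t\in[0,1].$$ Let $f_a(x)=\sum_{i=0}^m a_ix^i$, $f_b(x)=\sum_{i=0}^m b_ix^i$, $f_c(x)=\sum_{i=0}^m c_ix^i$. Assume that there exist $m$ real numbers $\lambda_1<\cdots<\lambda_m$ such that either $(-1)^iS(\lambda_i,t)\ge 0$ for all $t\in[0,1]$ and $i=1,\dots,m$, or $(-1)^iS(\lambda_i,t)\le 0$ for all $t\in[0,1]$ and $i=1,\dots,m$. Then the equation $\frac{dx}{dt}=S(x,t)$ either has constant periodic solutions, or satisfies the following condition: there exist $m$ zeros $\kappa_1<\cdots<\kappa_m$ of $f_a^2(x)-f_b^2(x)-f_c^2(x)$ such that either $(-1)^if_a(\kappa_i)\ge 0$ for $i=1,\dots,m$, or $(-1)^if_a(\kappa_i)\le 0$ for $i=1,\dots,m$.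
   Context: Here $x\in\mathbb R$. A periodic solution of $\frac{dx}{dt}=S(x,t)$ is a solution $x(t)$ defined on $[0,1]$ with $x(0)=x(1)$. A constant periodic solution is a solution $x(t)\equiv x_0$ with $x_0\in\mathbb R$; equivalently, $S(x_0,t)=0$ for all $t\in[0,1]$. The zeros $\kappa_1<\cdots<\kappa_m$ are real.
   Formalization: For m = 1 it is additionally assumed that a_1, b_1, c_1 are not all zero (S depends on x); without this the claim fails, e.g. m = 1, S = 1, λ_1 = 0. *)

theory Defs
  imports Complex_Main
begin

text \<open>Coefficient families are functions on all naturals; only the indices \<open>0, \<dots>, m\<close> are used.\<close>

definition poly_fun :: "nat \<Rightarrow> (nat \<Rightarrow> real) \<Rightarrow> real \<Rightarrow> real" where
  "poly_fun m a x = (\<Sum>i=0..m. a i * x ^ i)"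

definition S_rhs ::
  "nat \<Rightarrow> (nat \<Rightarrow> real) \<Rightarrow> (nat \<Rightarrow> real) \<Rightarrow> (nat \<Rightarrow> real) \<Rightarrow> real \<Rightarrow> real \<Rightarrow> real" where
  "S_rhs m a b c x t =
     (\<Sum>i=0..m. (a i + b i * cos (2 * pi * t) + c i * sin (2 * pi * t)) * x ^ i)"

text \<open>A solution on \<open>[0, 1]\<close> is a total function of which only the values on \<open>[0, 1]\<close> matter;
  derivatives at the endpoints are one-sided.\<close>

definition periodic_solution :: "(real \<Rightarrow> real \<Rightarrow> real) \<Rightarrow> (real \<Rightarrow> real) \<Rightarrow> bool" where
  "periodic_solution F x \<longleftrightarrow>
     (\<forall>t\<in>{0..1}. (x has_real_derivative F (x t) t) (at t within {0..1})) \<and> x 0 = x 1"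

definition constant_periodic_solution :: "(real \<Rightarrow> real \<Rightarrow> real) \<Rightarrow> (real \<Rightarrow> real) \<Rightarrow> bool" where
  "constant_periodic_solution F x \<longleftrightarrow>
     periodic_solution F x \<and> (\<exists>x0. \<forall>t\<in>{0..1}. x t = x0)"

end

theory Submission
  imports Defs
begin

text \<open>Write \<open>D = f\<^sub>a\<^sup>2 - f\<^sub>b\<^sup>2 - f\<^sub>c\<^sup>2\<close>. A sign of \<open>S(x, t)\<close> that does not depend on \<open>t\<close> means that
  \<open>f\<^sub>a(x)\<close> has this sign and \<open>D(x) \<ge> 0\<close>, and \<open>D < 0\<close> at the zeros of \<open>f\<^sub>a\<close> unless one of them
  yields a constant solution. Hence between two consecutive \<open>\<lambda>\<^sub>i\<close> the function \<open>D\<close> vanishes before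
  \<open>f\<^sub>a\<close> changes sign, which gives \<open>\<kappa>\<^sub>i \<in> [\<lambda>\<^sub>i, \<lambda>\<^sub>i\<^sub>+\<^sub>1)\<close> for \<open>i < m\<close>; the last zero is found in
  \<open>(\<kappa>\<^sub>m\<^sub>-\<^sub>1, \<lambda>\<^sub>m]\<close> in the same way, going backwards from \<open>\<lambda>\<^sub>m\<close>.\<close>

lemma S_rhs_eq:
  "S_rhs m a b c x t =
     poly_fun m a x + poly_fun m b x * cos (2 * pi * t) + poly_fun m c x * sin (2 * pi * t)"
  unfolding S_rhs_def poly_fun_def
  by (simp add: sum_distrib_right sum_distrib_left sum.distrib algebra_simps)

lemma continuous_on_poly_fun [continuous_intros]: "continuous_on A (poly_fun m a)"
  unfolding poly_fun_def by (intro continuous_intros)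

text \<open>The oscillating part \<open>B * cos + C * sin\<close> attains its minimum
  \<open>- sqrt (B\<^sup>2 + C\<^sup>2)\<close> at the angle \<theta> of the unit vector opposite to
  \<open>(B, C)\<close>, so the hypothesis is evaluated at
  \<open>t = \<theta> / (2 * pi)\<close>.\<close>

lemma trig_nonneg_imp_sqrt_le:
  fixes A B C :: real
  assumes "\<And>t. t \<in> {0..1} \<Longrightarrow> 0 \<le> A + B * cos (2 * pi * t) + C * sin (2 * pi * t)"
  shows "sqrt (B\<^sup>2 + C\<^sup>2) \<le> A"
proof (cases "B = 0 \<and> C = 0")
  case True
  then show ?thesis using assms[of 0] by simp
next
  case False
  define r where "r = sqrt (B\<^sup>2 + C\<^sup>2)"
  have r2: "r\<^sup>2 = B\<^sup>2 + C\<^sup>2" by (simp add: r_def)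
  have r: "r > 0" using False by (simp add: r_def sum_power2_gt_zero_iff)
  have "(- B / r)\<^sup>2 + (- C / r)\<^sup>2 = 1"
    using r by (simp add: power_divide add_divide_distrib[symmetric] r2[symmetric])
  then obtain \<theta> where \<theta>: "0 \<le> \<theta>" "\<theta> < 2 * pi" "- B / r = cos \<theta>" "- C / r = sin \<theta>"
    by (metis sincos_total_2pi)
  have "\<theta> / (2 * pi) \<in> {0..1}" using \<theta> by simp
  from assms[OF this] have "0 \<le> A + B * (- B / r) + C * (- C / r)"
    unfolding \<theta>(3,4) by simp
  also have "\<dots> = A - r\<^sup>2 / r"
    unfolding r2 by (simp add: power2_eq_square add_divide_distrib)
  also have "\<dots> = A - r" using r by (simp add: power2_eq_square)
  finally show ?thesis by (simp add: r_def)
qed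

lemma constant_periodic_solution_if_common_zero:
  assumes "poly_fun m a x = 0" "poly_fun m b x = 0" "poly_fun m c x = 0"
  shows "constant_periodic_solution (S_rhs m a b c) (\<lambda>_. x)"
  using assms by (auto simp: constant_periodic_solution_def periodic_solution_def S_rhs_eq)

text \<open>The order of \<open>p\<close> and \<open>q\<close> is left open because the search runs
  forwards from \<open>l i\<close> as well as backwards from \<open>l m\<close>.\<close>

lemma zero_before_sign_change:
  fixes f D :: "real \<Rightarrow> real"
  assumes f: "continuous_on UNIV f" and D: "continuous_on UNIV D"
    and neg: "\<And>x. f x = 0 \<Longrightarrow> D x < 0"
    and p: "f p \<ge> 0" "D p \<ge> 0" and q: "f q \<le> 0"
  obtains x where "min p q \<le> x" "x \<le> max p q" "D x = 0" "f x > 0"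
proof -
  \<comment> \<open>A zero of \<open>min f D\<close> is a zero of \<open>D\<close>, as \<open>D < 0\<close> where \<open>f\<close> vanishes.\<close>
  define h where "h = (\<lambda>x. min (f x) (D x))"
  have cont: "continuous_on A h" for A
    unfolding h_def using continuous_on_subset[OF f] continuous_on_subset[OF D]
    by (intro continuous_on_min) auto
  have hp: "h p \<ge> 0" and hq: "h q \<le> 0" using p q by (auto simp: h_def)
  have "\<exists>x. min p q \<le> x \<and> x \<le> max p q \<and> h x = 0"
  proof (cases "p \<le> q")
    case True
    then show ?thesis using IVT2'[of h q 0 p] hp hq cont by auto
  next
    case False
    then show ?thesis using IVT'[of h q 0 p] hp hq cont by auto
  qed
  then obtain x where x: "min p q \<le> x" "x \<le> max p q" "h x = 0" by blast
  then have "D x = 0 \<and> f x > 0"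
    using neg[of x] by (auto simp: h_def min_def split: if_splits)
  then show thesis using that x by blast
qed

lemma interlaced_zeros:
  fixes f D :: "real \<Rightarrow> real" and l \<sigma> :: "nat \<Rightarrow> real"
  assumes f: "continuous_on UNIV f" and D: "continuous_on UNIV D"
    and neg: "\<And>x. f x = 0 \<Longrightarrow> D x < 0"
    and m: "m \<ge> 2" and mono: "strict_mono_on {1..m} l"
    and \<sigma>: "\<And>i. \<sigma> (Suc i) = - \<sigma> i" "\<And>i. \<sigma> i \<noteq> 0"
    and sgn: "\<And>i. i \<in> {1..m} \<Longrightarrow> \<sigma> i * f (l i) \<ge> 0"
    and nonneg: "\<And>i. i \<in> {1..m} \<Longrightarrow> D (l i) \<ge> 0"
  obtains \<kappa> where "strict_mono_on {1..m} \<kappa>"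
    "\<And>i. i \<in> {1..m} \<Longrightarrow> D (\<kappa> i) = 0" "\<And>i. i \<in> {1..m} \<Longrightarrow> \<sigma> i * f (\<kappa> i) > 0"
proof -
  have cont: "continuous_on UNIV (\<lambda>x. \<sigma> i * f x)" for i
    using f by (intro continuous_intros)
  have neg': "D x < 0" if "\<sigma> i * f x = 0" for i x
    using that neg \<sigma>(2) by simp
  have "\<exists>x. l i \<le> x \<and> x < l (Suc i) \<and> D x = 0 \<and> \<sigma> i * f x > 0"
    if i: "i \<in> {1..<m}" for i
  proof -
    have lt: "l i < l (Suc i)" using mono i by (auto simp: strict_mono_on_def)
    have opp: "\<sigma> i * f (l (Suc i)) \<le> 0" using sgn[of "Suc i"] i \<sigma>(1)[of i] by auto
    obtain x where x: "min (l i) (l (Suc i)) \<le> x" "x \<le> max (l i) (l (Suc i))"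
      "D x = 0" "\<sigma> i * f x > 0"
      using zero_before_sign_change[OF cont[of i] D neg'[of i] _ _ opp, where p = "l i"] sgn[of i] nonneg[of i] i
      by auto
    \<comment> \<open>Strict positivity excludes the right end, so zeros from adjacent intervals
      cannot coincide.\<close>
    moreover have "x \<noteq> l (Suc i)" using x(4) opp by auto
    ultimately show ?thesis using lt by (intro exI[of _ x]) auto
  qed
  then obtain k where k: "\<And>i. i \<in> {1..<m} \<Longrightarrow>
      l i \<le> k i \<and> k i < l (Suc i) \<and> D (k i) = 0 \<and> \<sigma> i * f (k i) > 0"
    by metis
  define n where "n = m - 1"
  have n: "m = Suc n" "n \<in> {1..<m}" using m by (auto simp: n_def)
  \<comment> \<open>No \<open>l\<close> follows \<open>l m\<close>; the previous zero
    \<open>k n\<close> takes over as the point of opposite sign. This is where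
    \<open>m \<ge> 2\<close> enters.\<close>
  have opp: "\<sigma> m * f (k n) \<le> 0" using k[OF n(2)] \<sigma>(1)[of n] n(1) by simp
  obtain z where z: "min (l m) (k n) \<le> z" "D z = 0" "\<sigma> m * f z > 0"
    using zero_before_sign_change[OF cont[of m] D neg'[of m] _ _ opp, where p = "l m"] sgn[of m] nonneg[of m] m
    by auto
  have "z \<noteq> k n" using z(3) opp by auto
  then have "k n < z" using z(1) k[OF n(2)] n(1) by auto
  define \<kappa> where "\<kappa> = (\<lambda>i. if i < m then k i else z)"
  have kmono: "k i < k j" if "i \<in> {1..<m}" "j \<in> {1..<m}" "i < j" for i j
  proof -
    have "l (Suc i) \<le> l j"
      using strict_mono_on_leD[OF mono, of "Suc i" j] that by auto
    then show ?thesis using k[OF that(1)] k[OF that(2)] by linarith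
  qed
  have "strict_mono_on {1..m} \<kappa>"
  proof (rule strict_mono_onI)
    fix i j assume ij: "i \<in> {1..m}" "j \<in> {1..m}" "i < j"
    show "\<kappa> i < \<kappa> j"
    proof (cases "j < m")
      case True
      then show ?thesis using kmono[of i j] ij by (simp add: \<kappa>_def)
    next
      case False
      then have "k i \<le> k n" using kmono[of i n] ij n by (cases "i = n") auto
      then show ?thesis using \<open>k n < z\<close> False ij by (simp add: \<kappa>_def)
    qed
  qed
  moreover have "D (\<kappa> i) = 0 \<and> \<sigma> i * f (\<kappa> i) > 0" if "i \<in> {1..m}" for i
    using k[of i] z that by (cases "i < m") (auto simp: \<kappa>_def)
  ultimately show thesis using that by blast
qed

(* The hypothesis nondeg only excludes the case where m = 1 and S does not depend on x.  There the
   claim fails: for S = 1 the other hypotheses hold with lam 1 = 0, but there is no constant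
   periodic solution, and f_a^2 - f_b^2 - f_c^2 = 1 has no zero. *)

theorem proposition1p4:
  fixes m :: nat and a b c :: "nat \<Rightarrow> real"
  assumes m: "m \<ge> 1"
    and nondeg: "m = 1 \<Longrightarrow> \<not> (a m = 0 \<and> b m = 0 \<and> c m = 0)"
    and alternating: "\<exists>lam :: nat \<Rightarrow> real. strict_mono_on {1..m} lam \<and>
      ((\<forall>t\<in>{0..1}. \<forall>i\<in>{1..m}. (-1) ^ i * S_rhs m a b c (lam i) t \<ge> 0) \<or>
       (\<forall>t\<in>{0..1}. \<forall>i\<in>{1..m}. (-1) ^ i * S_rhs m a b c (lam i) t \<le> 0))"
  shows "(\<exists>x. constant_periodic_solution (S_rhs m a b c) x) \<or>
    (\<exists>\<kappa> :: nat \<Rightarrow> real. strict_mono_on {1..m} \<kappa> \<and>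
      (\<forall>i\<in>{1..m}. (poly_fun m a (\<kappa> i))\<^sup>2 - (poly_fun m b (\<kappa> i))\<^sup>2 - (poly_fun m c (\<kappa> i))\<^sup>2 = 0) \<and>
      ((\<forall>i\<in>{1..m}. (-1) ^ i * poly_fun m a (\<kappa> i) \<ge> 0) \<or>
       (\<forall>i\<in>{1..m}. (-1) ^ i * poly_fun m a (\<kappa> i) \<le> 0)))"
proof (rule disjCI)
  define D where "D = (\<lambda>x. (poly_fun m a x)\<^sup>2 - (poly_fun m b x)\<^sup>2 - (poly_fun m c x)\<^sup>2)"
  assume "\<nexists>\<kappa> :: nat \<Rightarrow> real. strict_mono_on {1..m} \<kappa> \<and>
      (\<forall>i\<in>{1..m}. (poly_fun m a (\<kappa> i))\<^sup>2 - (poly_fun m b (\<kappa> i))\<^sup>2 - (poly_fun m c (\<kappa> i))\<^sup>2 = 0) \<and>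
      ((\<forall>i\<in>{1..m}. (-1) ^ i * poly_fun m a (\<kappa> i) \<ge> 0) \<or>
       (\<forall>i\<in>{1..m}. (-1) ^ i * poly_fun m a (\<kappa> i) \<le> 0))"
  then have no_kappa: False
    if "strict_mono_on {1..m} \<kappa>" "\<And>i. i \<in> {1..m} \<Longrightarrow> D (\<kappa> i) = 0"
      "(\<forall>i\<in>{1..m}. (-1) ^ i * poly_fun m a (\<kappa> i) \<ge> 0) \<or>
       (\<forall>i\<in>{1..m}. (-1) ^ i * poly_fun m a (\<kappa> i) \<le> 0)" for \<kappa>
    using that unfolding D_def by blast
  have contD: "continuous_on A D" for A
    unfolding D_def by (intro continuous_intros)
  \<comment> \<open>The sign \<open>s\<close> merges the two alternatives of the hypothesis.\<close>
  obtain lam s where mono: "strict_mono_on {1..m} lam" and s: "s = 1 \<or> s = (-1::real)"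
    and S: "\<And>i t. i \<in> {1..m} \<Longrightarrow> t \<in> {0..1} \<Longrightarrow> 0 \<le> s * (-1) ^ i * S_rhs m a b c (lam i) t"
  proof -
    obtain lam where "strict_mono_on {1..m} lam" and
      "(\<forall>t\<in>{0..1}. \<forall>i\<in>{1..m}. (-1) ^ i * S_rhs m a b c (lam i) t \<ge> 0) \<or>
       (\<forall>t\<in>{0..1}. \<forall>i\<in>{1..m}. (-1) ^ i * S_rhs m a b c (lam i) t \<le> 0)"
      using alternating by blast
    then show thesis using that[of lam 1] that[of lam "-1"] by auto
  qed
  define \<sigma> where "\<sigma> = (\<lambda>i::nat. s * (-1) ^ i)"
  have \<sigma>2: "(\<sigma> i)\<^sup>2 = 1" for i
    using s by (auto simp: \<sigma>_def power_mult_distrib simp flip: power_mult)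
  have sgn: "\<sigma> i * poly_fun m a (lam i) \<ge> 0" and nonneg: "D (lam i) \<ge> 0"
    if i: "i \<in> {1..m}" for i
  proof -
    have *: "sqrt ((\<sigma> i * poly_fun m b (lam i))\<^sup>2 + (\<sigma> i * poly_fun m c (lam i))\<^sup>2)
        \<le> \<sigma> i * poly_fun m a (lam i)"
      using S[OF i] by (intro trig_nonneg_imp_sqrt_le) (simp add: \<sigma>_def S_rhs_eq algebra_simps)
    show "\<sigma> i * poly_fun m a (lam i) \<ge> 0"
      by (rule order_trans[OF _ *]) simp
    show "D (lam i) \<ge> 0"
      using sqrt_le_D[OF *] by (simp add: D_def power_mult_distrib \<sigma>2)
  qed
  show "\<exists>x. constant_periodic_solution (S_rhs m a b c) x"
  proof (rule ccontr)
    assume no_const: "\<nexists>x. constant_periodic_solution (S_rhs m a b c) x"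
    \<comment> \<open>Here \<open>D x\<close> is minus the sum of the squares of the other two
      polynomials; if both vanished too, \<open>x\<close> would be a constant solution.\<close>
    have neg: "D x < 0" if "poly_fun m a x = 0" for x
    proof -
      have "poly_fun m b x \<noteq> 0 \<or> poly_fun m c x \<noteq> 0"
        using constant_periodic_solution_if_common_zero[OF that] no_const by blast
      then show ?thesis
        using that sum_power2_gt_zero_iff[of "poly_fun m b x" "poly_fun m c x"] by (simp add: D_def)
    qed
    show False
    proof (cases "m = 1")
      case True
      have lin: "poly_fun m d x = d 0 + d 1 * x" for d x
        using True by (simp add: poly_fun_def)
      obtain p where p: "D p \<ge> 0" using nonneg True by auto
      \<comment> \<open>Choose a zero of \<open>f\<^sub>a\<close>, \<open>f\<^sub>a - f\<^sub>b\<close> or \<open>f\<^sub>a - f\<^sub>c\<close>, whichever is not constant.\<close>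
      have "\<exists>q. D q \<le> 0"
      proof -
        consider "a 1 \<noteq> 0" | "a 1 = 0" "b 1 \<noteq> 0" | "a 1 = 0" "c 1 \<noteq> 0"
          using nondeg True by auto
        then show ?thesis
        proof cases
          case 1
          then show ?thesis by (intro exI[of _ "- a 0 / a 1"]) (simp add: D_def lin)
        next
          case 2
          then show ?thesis by (intro exI[of _ "(a 0 - b 0) / b 1"]) (simp add: D_def lin)
        next
          case 3
          then show ?thesis by (intro exI[of _ "(a 0 - c 0) / c 1"]) (simp add: D_def lin)
        qed
      qed
      then obtain q where q: "D q \<le> 0" by blast
      have "\<exists>z. D z = 0"
        using IVT'[of D q 0 p] IVT2'[of D q 0 p] p q contD linear[of p q] by blast
      then obtain z where "D z = 0" by blast
      \<comment> \<open>With a single index one of the two sign alternatives always holds, so any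
        zero of \<open>D\<close> will do.\<close>
      then show False
        using True by (intro no_kappa[of "\<lambda>_. z"]) (auto simp: strict_mono_on_def)
    next
      case False
      then have "m \<ge> 2" using m by simp
      moreover have "\<sigma> (Suc i) = - \<sigma> i" "\<sigma> i \<noteq> 0" for i
        using s by (auto simp: \<sigma>_def)
      ultimately obtain \<kappa> where \<kappa>: "strict_mono_on {1..m} \<kappa>"
        "\<And>i. i \<in> {1..m} \<Longrightarrow> D (\<kappa> i) = 0" "\<And>i. i \<in> {1..m} \<Longrightarrow> \<sigma> i * poly_fun m a (\<kappa> i) > 0"
        using interlaced_zeros[OF continuous_on_poly_fun contD neg _ mono _ _ sgn nonneg] by metis
      show False
        using s \<kappa>(3) by (intro no_kappa[OF \<kappa>(1,2)]) (fastforce simp: \<sigma>_def intro: less_imp_le)+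
    qed
  qed
qed

end
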